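(* Let $H$ be a separable Hilbert space and let $\{x_k\}_{k=1}^\infty$ be a hereditarily complete system in $H$ with biorthogonal system $\{x_k^*\}_{k=1}^\infty$. Then for any $\sigma\subset\mathbb{N}$ the system $\{x_k\}_{k\in\sigma}\cup\{x_k^*\}_{k\in\sigma^c}$ (that is, the system $\{w_k\}_{k=1}^\infty$ with $w_k=x_k$ for $k\in\sigma$ and $w_k=x_k^*$ for $k\in\sigma^c$) is also hereditarily complete.
   Context: $\sigma^c=\mathbb{N}\setminus\sigma$. A system $\{x_k\}_{k=1}^\infty$ in $H$ is complete if its closed linear span is $H$; it is minimal if for every $k$ the vector $x_k$ does not lie in the closed linear span of $\{x_j\}_{j\ne k}$. Minimality is equivalent to the existence of a biorthogonal system $\{x_k^*\}_{k=1}^\infty\subset H$, i.e. $(x_k,x_j^* )=\delta_{k,j}$; if the system is complete, the biorthogonal system is unique. A complete system $\{x_k\}_{k=1}^\infty$ is hereditarily complete if it is minimal and for each $x\in H$ the vector $x$ belongs to the closed linear span of $\{(x,x_k^* )x_k\}_{k=1}^\infty$. *)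

theory Defs
  imports "HOL-Analysis.Analysis" "Jordan_Normal_Form.Conjugate"
begin

text \<open>The two scalar fields of Hilbert space theory, treated uniformly. By the Gelfand--Mazur
  theorem, \<open>real\<close> and \<open>complex\<close> are up to isomorphism the only instances. The last axiom
  determines the conjugation.\<close>

class rc_field = real_normed_field + conjugatable_field +
  assumes mult_conjugate_eq_norm: "a * conjugate a = (norm a)\<^sup>2 *\<^sub>R 1"

instance real :: rc_field
  by standard (simp add: power2_eq_square)

instance complex :: rc_field
  by standard (simp add: scaleR_conv_of_real complex_norm_square flip: of_real_power)

text \<open>Hilbert spaces over such a field, with inner product linear in the first argument. Norm,
  topology and metric completeness come from the class \<open>banach\<close>; the locale axioms tie the
  norm and the real scalar multiplication of that class to \<open>ip\<close> and \<open>scale\<close>.\<close>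

locale hilbert_space = vector_space scale
  for scale :: "'k::rc_field \<Rightarrow> 'h::banach \<Rightarrow> 'h" +
  fixes ip :: "'h \<Rightarrow> 'h \<Rightarrow> 'k"
  assumes scale_of_real: "scale (of_real r) x = r *\<^sub>R x"
    and ip_add_left: "ip (x + y) z = ip x z + ip y z"
    and ip_scale_left: "ip (scale a x) y = a * ip x y"
    and ip_commute: "ip x y = conjugate (ip y x)"
    and ip_self: "ip x x = of_real ((norm x)\<^sup>2)"
begin

definition closed_span :: "'h set \<Rightarrow> 'h set" where
  "closed_span S = closure (span S)"

definition complete_system :: "(nat \<Rightarrow> 'h) \<Rightarrow> bool" where
  "complete_system x \<longleftrightarrow> closed_span (range x) = UNIV"

definition minimal_system :: "(nat \<Rightarrow> 'h) \<Rightarrow> bool" where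
  "minimal_system x \<longleftrightarrow> (\<forall>k. x k \<notin> closed_span (x ` {j. j \<noteq> k}))"

definition biorthogonal :: "(nat \<Rightarrow> 'h) \<Rightarrow> (nat \<Rightarrow> 'h) \<Rightarrow> bool" where
  "biorthogonal x y \<longleftrightarrow> (\<forall>k j. ip (x k) (y j) = (if k = j then 1 else 0))"

text \<open>For a complete system the witness \<open>y\<close> below is unique (see \<open>biorthogonal_unique\<close>), so
  it is the biorthogonal system of \<open>x\<close>.\<close>

definition hereditarily_complete :: "(nat \<Rightarrow> 'h) \<Rightarrow> bool" where
  "hereditarily_complete x \<longleftrightarrow>
     complete_system x \<and> minimal_system x \<and>
     (\<exists>y. biorthogonal x y \<and> (\<forall>h. h \<in> closed_span (range (\<lambda>k. scale (ip h (y k)) (x k)))))"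

lemma ip_add_right: "ip x (y + z) = ip x y + ip x z"
  by (metis ip_add_left ip_commute conjugate_dist_add)

lemma ip_scale_right: "ip x (scale a y) = conjugate a * ip x y"
  by (metis ip_scale_left ip_commute conjugate_dist_mul)

lemma ip_zero_left: "ip 0 x = 0"
  by (metis add_cancel_right_right ip_add_left)

lemma ip_diff_right: "ip x (y - z) = ip x y - ip x z"
  by (metis add_diff_cancel_right' diff_add_cancel ip_add_right)

lemma norm_add_orthogonal:
  assumes "ip x y = 0"
  shows "(norm (x + y))\<^sup>2 = (norm x)\<^sup>2 + (norm y)\<^sup>2"
proof -
  have "ip y x = 0" using assms ip_commute[of y x] by simp
  then have "ip (x + y) (x + y) = ip x x + ip y y"
    using assms by (simp add: ip_add_left ip_add_right)
  then have "(of_real ((norm (x + y))\<^sup>2) :: 'k) = of_real ((norm x)\<^sup>2 + (norm y)\<^sup>2)"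
    by (simp add: ip_self)
  then show ?thesis using of_real_eq_iff by blast
qed

lemma orthogonal_closed_span:
  assumes S: "\<And>s. s \<in> S \<Longrightarrow> ip s y = 0" and y: "y \<in> closed_span S"
  shows "y = 0"
proof (rule ccontr)
  assume "y \<noteq> 0"
  then obtain z where z: "z \<in> span S" "dist z y < norm y"
    using y unfolding closed_span_def closure_approachable by (metis zero_less_norm_iff)
  from z(1) have "ip z y = 0"
  proof (induction rule: span_induct_alt)
    case base
    then show ?case by (simp add: ip_zero_left)
  next
    case (step c a b)
    then show ?case using S by (simp add: ip_add_left ip_scale_left)
  qed
  then have "ip (- z) y = 0"
    using ip_scale_left[of "- 1" z y] by simp
  from norm_add_orthogonal[OF this] have "(norm y)\<^sup>2 \<le> (norm (- z + y))\<^sup>2"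
    by simp
  then have "norm y \<le> norm (- z + y)"
    using power2_le_imp_le norm_ge_zero by blast
  then show False using z(2) by (simp add: dist_norm norm_minus_commute)
qed

lemma biorthogonal_unique:
  assumes "complete_system x" "biorthogonal x y" "biorthogonal x z"
  shows "y = z"
proof
  fix j
  have "y j - z j = 0"
  proof (rule orthogonal_closed_span)
    show "ip s (y j - z j) = 0" if "s \<in> range x" for s
      using that assms(2,3) by (auto simp: biorthogonal_def ip_diff_right)
  qed (use assms(1) in \<open>simp add: complete_system_def\<close>)
  then show "y j = z j" by simp
qed

end

lemma hilbert_space_real_inner:
  "hilbert_space (scaleR :: real \<Rightarrow> 'a \<Rightarrow> 'a) (inner :: 'a::{real_inner,banach} \<Rightarrow> 'a \<Rightarrow> real)"
  by unfold_locales
    (auto simp: algebra_simps inner_add_left inner_commute power2_norm_eq_inner)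

lemma hilbert_space_complex:
  "hilbert_space ((*) :: complex \<Rightarrow> complex \<Rightarrow> complex) (\<lambda>x y. x * cnj y)"
  by unfold_locales
    (auto simp: algebra_simps scaleR_conv_of_real complex_norm_square simp flip: of_real_power)

end

theory Submission
  imports Defs
begin

text \<open>A minimal complete system \<open>x\<close> with biorthogonal system \<open>y\<close> is hereditarily complete if and
  only if each mixed system, with \<open>x k\<close> for \<open>k \<in> \<tau>\<close> and \<open>y k\<close> for \<open>k \<notin> \<tau>\<close>, is complete.
  Let \<open>P\<close> be the orthogonal projection onto the closed span of the \<open>x k\<close>, \<open>k \<in> \<sigma>\<close>. The system
  \<open>w\<close> of the theorem is biorthogonal to \<open>P (xs k)\<close> for \<open>k \<in> \<sigma>\<close> and \<open>x k - P (x k)\<close> for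
  \<open>k \<notin> \<sigma>\<close>. If \<open>h\<close> is orthogonal to the mixed system formed from \<open>w\<close> and a set \<open>\<tau>\<close>, then \<open>P h\<close>
  and \<open>h - P h\<close> are each orthogonal to a mixed system formed from \<open>x\<close>, for the sets
  \<open>\<sigma> \<inter> \<tau>\<close> and \<open>\<sigma> \<union> - \<tau>\<close>. Hence both vanish.\<close>

context hilbert_space
begin

section \<open>Inner product identities and the Cauchy-Schwarz inequality\<close>

lemma ip_diff_left: "ip (x - y) z = ip x z - ip y z"
  by (metis add_diff_cancel_right' diff_add_cancel ip_add_left)

lemma ip_eq_0_commute: "ip x y = 0 \<longleftrightarrow> ip y x = 0"
  by (metis ip_commute conjugate_zero_iff)

lemma norm_scale: "norm (scale a x) = norm a * norm x"
proof -
  have "(of_real ((norm (scale a x))\<^sup>2) :: 'k) = (a * conjugate a) * of_real ((norm x)\<^sup>2)"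
    by (simp only: ip_self[symmetric] ip_scale_left ip_scale_right mult_ac)
  also have "\<dots> = of_real ((norm a * norm x)\<^sup>2)"
    by (simp add: mult_conjugate_eq_norm of_real_def power_mult_distrib)
  finally have "(norm (scale a x))\<^sup>2 = (norm a * norm x)\<^sup>2"
    using of_real_eq_iff by blast
  then show ?thesis by simp
qed

lemma parallelogram_law:
  fixes x y :: 'h
  shows "(norm (x + y))\<^sup>2 + (norm (x - y))\<^sup>2 = 2 * (norm x)\<^sup>2 + 2 * (norm y)\<^sup>2"
proof -
  have "ip (x + y) (x + y) + ip (x - y) (x - y) = 2 * ip x x + 2 * ip y y"
    by (simp add: ip_add_left ip_add_right ip_diff_left ip_diff_right)
  then have "(of_real ((norm (x + y))\<^sup>2 + (norm (x - y))\<^sup>2) :: 'k)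
      = of_real (2 * (norm x)\<^sup>2 + 2 * (norm y)\<^sup>2)"
    by (simp add: ip_self)
  then show ?thesis using of_real_eq_iff by blast
qed

text \<open>\<open>scale a y\<close> is the component of \<open>x\<close> along \<open>y\<close>, so
  the norm identity is Pythagoras. It serves both Cauchy-Schwarz and the orthogonality of nearest
  points.\<close>

lemma orthogonal_component_vector:
  fixes x y :: 'h
  assumes "y \<noteq> 0"
  defines "a \<equiv> ip x y / of_real ((norm y)\<^sup>2)"
  shows "ip (x - scale a y) y = 0"
    and "(norm x)\<^sup>2 = (norm (x - scale a y))\<^sup>2 + (norm a * norm y)\<^sup>2"
proof -
  show orth: "ip (x - scale a y) y = 0"
    using assms by (simp add: ip_diff_left ip_scale_left ip_self)
  then have "ip (x - scale a y) (scale a y) = 0"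
    by (simp add: ip_scale_right)
  from norm_add_orthogonal[OF this]
  show "(norm x)\<^sup>2 = (norm (x - scale a y))\<^sup>2 + (norm a * norm y)\<^sup>2"
    by (simp add: norm_scale)
qed

lemma norm_ip_le: "norm (ip x y) \<le> norm x * norm y"
proof (cases "y = 0")
  case True
  then show ?thesis using ip_eq_0_commute[of x y] by (simp add: ip_zero_left)
next
  case False
  let ?a = "ip x y / of_real ((norm y)\<^sup>2)"
  have "(norm ?a * norm y)\<^sup>2 \<le> (norm x)\<^sup>2"
    using orthogonal_component_vector(2)[OF False, of x] by simp
  then have "norm ?a * norm y \<le> norm x"
    using power2_le_imp_le norm_ge_zero by blast
  moreover have "norm ?a * norm y = norm (ip x y) / norm y"
    using False by (simp add: norm_divide norm_mult power2_eq_square)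
  ultimately show ?thesis
    using False by (simp add: divide_le_eq)
qed

text \<open>Cauchy-Schwarz gives the bound; the resulting continuity makes orthogonal complements
  closed.\<close>

lemma bounded_linear_ip: "bounded_linear (\<lambda>x. ip x y)"
proof (rule bounded_linear_intro[where K = "norm y"])
  show "ip (r *\<^sub>R x) y = r *\<^sub>R ip x y" for r x
    by (metis scale_of_real ip_scale_left scaleR_conv_of_real)
qed (auto simp: ip_add_left norm_ip_le)

section \<open>Closed spans\<close>

lemma closed_span_base: "s \<in> S \<Longrightarrow> s \<in> closed_span S"
  unfolding closed_span_def using span_base closure_subset by blast

lemma ip_closed_span_eq_0:
  assumes S: "\<And>s. s \<in> S \<Longrightarrow> ip s y = 0" and z: "z \<in> closed_span S"
  shows "ip z y = 0"
proof -
  have "span S \<subseteq> {z. ip z y = 0}"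
  proof
    fix z assume "z \<in> span S"
    then show "z \<in> {z. ip z y = 0}"
      by (induction rule: span_induct_alt) (auto simp: S ip_zero_left ip_add_left ip_scale_left)
  qed
  moreover have "closed {z. ip z y = 0}"
    by (intro closed_Collect_eq continuous_intros linear_continuous_on bounded_linear_ip)
  ultimately show ?thesis
    using z closure_minimal unfolding closed_span_def by blast
qed

text \<open>Real scalars suffice here: convexity, needed for nearest points, is a notion of real
  vector spaces.\<close>

lemma real_subspace_closed_span: "real_vector.subspace (closed_span S)"
  unfolding closed_span_def
proof (rule real_vector.subspaceI)
  show "0 \<in> closure (span S)"
    using closure_subset span_zero by blast
next
  fix y z assume "y \<in> closure (span S)" "z \<in> closure (span S)"
  then obtain f g where "\<And>n. f n \<in> span S" "f \<longlonglongrightarrow> y" "\<And>n. g n \<in> span S" "g \<longlonglongrightarrow> z"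
    unfolding closure_sequential by blast
  then have "\<And>n. f n + g n \<in> span S" "(\<lambda>n. f n + g n) \<longlonglongrightarrow> y + z"
    by (simp_all add: span_add tendsto_add)
  then show "y + z \<in> closure (span S)"
    unfolding closure_sequential by (intro exI[of _ "\<lambda>n. f n + g n"]) simp
next
  fix r :: real and z assume "z \<in> closure (span S)"
  then obtain f where "\<And>n. f n \<in> span S" "f \<longlonglongrightarrow> z"
    unfolding closure_sequential by blast
  then have "\<And>n. scale (of_real r) (f n) \<in> span S" "(\<lambda>n. r *\<^sub>R f n) \<longlonglongrightarrow> r *\<^sub>R z"
    by (simp_all add: span_scale tendsto_scaleR)
  then show "r *\<^sub>R z \<in> closure (span S)"
    unfolding closure_sequential by (intro exI[of _ "\<lambda>n. r *\<^sub>R f n"]) (simp add: scale_of_real)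
qed

text \<open>Nonzero coefficients are invertible, so only the support of \<open>c\<close> matters.
  This turns the condition on \<open>h\<close> in hereditary completeness into one on the set of
  \<open>k\<close> with \<open>ip h (y k)\<close> nonzero.\<close>

lemma closed_span_scale_range:
  "closed_span (range (\<lambda>k. scale (c k) (x k))) = closed_span (x ` {k. c k \<noteq> 0})"
proof -
  have "scale (c k) (x k) \<in> span (x ` {k. c k \<noteq> 0})" for k
    by (cases "c k = 0") (simp_all add: span_zero span_scale span_base)
  moreover have "x k \<in> span (range (\<lambda>k. scale (c k) (x k)))" if "c k \<noteq> 0" for k
  proof -
    have "scale (inverse (c k)) (scale (c k) (x k)) \<in> span (range (\<lambda>k. scale (c k) (x k)))"
      by (intro span_scale span_base rangeI)
    then show ?thesis using that by simp
  qed
  ultimately have "span (range (\<lambda>k. scale (c k) (x k))) = span (x ` {k. c k \<noteq> 0})"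
    unfolding span_eq by blast
  then show ?thesis by (simp add: closed_span_def)
qed

section \<open>Orthogonal projection\<close>

text \<open>A sequence in \<open>C\<close> minimising the distance to \<open>h\<close> is Cauchy by
  the parallelogram law, and its limit is nearest.\<close>

lemma closed_convex_nearest_point:
  fixes h :: 'h
  assumes "closed C" "convex C" "C \<noteq> {}"
  obtains p where "p \<in> C" "\<And>z. z \<in> C \<Longrightarrow> norm (h - p) \<le> norm (h - z)"
proof -
  define D where "D = (INF z\<in>C. (norm (h - z))\<^sup>2)"
  have bdd: "bdd_below ((\<lambda>z. (norm (h - z))\<^sup>2) ` C)"
    by (rule bdd_belowI[of _ 0]) auto
  have D_le: "D \<le> (norm (h - z))\<^sup>2" if "z \<in> C" for z
    unfolding D_def using that bdd by (rule cINF_lower[rotated])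
  have "\<exists>z\<in>C. (norm (h - z))\<^sup>2 < D + 1 / Suc n" for n
    using cINF_less_iff[OF assms(3) bdd, of "D + 1 / Suc n"] by (simp flip: D_def)
  then obtain f where f: "\<And>n. f n \<in> C" "\<And>n. (norm (h - f n))\<^sup>2 < D + 1 / Suc n"
    by metis
  have near: "(norm (f m - f n))\<^sup>2 \<le> 2 / Suc m + 2 / Suc n" for m n
  proof -
    \<comment> \<open>The midpoint stays in \<open>C\<close>, which bounds the sum term of the
      parallelogram law below by \<open>4 * D\<close>; this cancels the \<open>4 * D\<close> on the
      other side.\<close>
    let ?z = "(1/2) *\<^sub>R f m + (1/2) *\<^sub>R f n"
    have "?z \<in> C" by (rule convexD[OF assms(2)]) (use f in auto)
    moreover have "(h - f m) + (h - f n) = 2 *\<^sub>R (h - ?z)"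
      by (simp add: algebra_simps scaleR_2)
    ultimately have "4 * D \<le> (norm ((h - f m) + (h - f n)))\<^sup>2"
      using D_le by (simp add: power_mult_distrib)
    then show ?thesis
      using parallelogram_law[of "h - f m" "h - f n"] f(2)[of m] f(2)[of n]
      by (simp add: norm_minus_commute)
  qed
  have "Cauchy f"
  proof (rule CauchyI)
    fix e :: real assume "e > 0"
    \<comment> \<open>With this \<open>N\<close> each of the two terms in \<open>near\<close> is
      below half of the square of \<open>e\<close>.\<close>
    then obtain N where N: "1 / real (Suc N) < e\<^sup>2 / 4"
      by (metis nat_approx_posE zero_less_power zero_less_divide_iff zero_less_numeral)
    have "norm (f m - f n) < e" if "m \<ge> N" "n \<ge> N" for m n
    proof -
      have "1 / real (Suc m) \<le> 1 / Suc N" "1 / real (Suc n) \<le> 1 / Suc N"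
        using that by (auto simp: frac_le)
      then have "(norm (f m - f n))\<^sup>2 < e\<^sup>2" using near[of m n] N by simp
      then show ?thesis using \<open>e > 0\<close> power2_less_imp_less less_imp_le by blast
    qed
    then show "\<exists>N. \<forall>m\<ge>N. \<forall>n\<ge>N. norm (f m - f n) < e" by blast
  qed
  then obtain p where p: "f \<longlonglongrightarrow> p"
    using Cauchy_convergent convergent_def by blast
  have "(\<lambda>n. (norm (h - f n))\<^sup>2) \<longlonglongrightarrow> (norm (h - p))\<^sup>2"
    by (intro tendsto_intros p)
  moreover have "(\<lambda>n. D + 1 / Suc n) \<longlonglongrightarrow> D + 0"
    by (intro tendsto_intros LIMSEQ_Suc lim_1_over_n)
  ultimately have "(norm (h - p))\<^sup>2 \<le> D + 0"
    by (rule LIMSEQ_le) (use f(2) less_imp_le in blast)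
  then have "norm (h - p) \<le> norm (h - z)" if "z \<in> C" for z
    using D_le[OF that] by (intro power2_le_imp_le[OF _ norm_ge_zero]) linarith
  moreover have "p \<in> C"
    using closed_sequentially[OF assms(1) _ p] f(1) by blast
  ultimately show ?thesis using that by blast
qed

text \<open>Take the nearest point \<open>p\<close>. If \<open>h - p\<close> had a nonzero component
  along some \<open>s\<close>, adding it to \<open>p\<close> would give a closer point.\<close>

lemma orthogonal_projection_exists:
  "\<exists>p\<in>closed_span S. \<forall>s\<in>closed_span S. ip s (h - p) = 0"
proof -
  have sub: "real_vector.subspace (closed_span S)"
    by (rule real_subspace_closed_span)
  obtain p where p: "p \<in> closed_span S"
    and min: "\<And>z. z \<in> closed_span S \<Longrightarrow> norm (h - p) \<le> norm (h - z)"
  proof (rule closed_convex_nearest_point[where h = h])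
    show "closed (closed_span S)" by (simp add: closed_span_def)
    show "convex (closed_span S)" using sub by (rule subspace_imp_convex)
    show "closed_span S \<noteq> {}" using real_vector.subspace_0[OF sub] by blast
  qed blast
  have "ip s (h - p) = 0" if s: "s \<in> S" for s
  proof (cases "s = 0")
    case True
    then show ?thesis by (simp add: ip_zero_left)
  next
    case False
    define a where "a = ip (h - p) s / of_real ((norm s)\<^sup>2)"
    have "scale a s \<in> closed_span S"
      using s span_scale span_base closure_subset unfolding closed_span_def by blast
    then have "norm (h - p) \<le> norm (h - (p + scale a s))"
      using p min real_vector.subspace_add[OF sub] by blast
    then have "norm (h - p) \<le> norm (h - p - scale a s)"
      by (simp add: diff_diff_eq)
    then have "(norm (h - p))\<^sup>2 \<le> (norm (h - p - scale a s))\<^sup>2"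
      by (simp add: power_mono)
    then have "(norm a * norm s)\<^sup>2 \<le> 0"
      using orthogonal_component_vector(2)[OF False, of "h - p"] unfolding a_def by simp
    then have "a = 0" using False by simp
    then have "ip (h - p) s = 0" using False by (simp add: a_def)
    then show ?thesis using ip_eq_0_commute by blast
  qed
  then show ?thesis using p ip_closed_span_eq_0 by blast
qed

section \<open>Hereditary completeness and mixed systems\<close>

lemma biorthogonal_imp_minimal:
  assumes "biorthogonal x y"
  shows "minimal_system x"
  unfolding minimal_system_def
proof (intro allI notI)
  fix k assume "x k \<in> closed_span (x ` {j. j \<noteq> k})"
  then have "ip (x k) (y k) = 0"
    by (rule ip_closed_span_eq_0[rotated]) (use assms in \<open>auto simp: biorthogonal_def\<close>)
  then show False using assms by (simp add: biorthogonal_def)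
qed

text \<open>Forward: \<open>h\<close> lies in the closed span of the \<open>x k\<close> with
  \<open>ip h (y k)\<close> nonzero; these \<open>k\<close> belong to \<tau>, so \<open>h\<close> is
  orthogonal to that span and vanishes. Backward: project \<open>h\<close> onto the closed span of
  the \<open>x k\<close> with \<open>k\<close> in \<tau>; the remainder is orthogonal to the mixed
  system.\<close>

lemma hereditarily_complete_iff_mixed_complete:
  assumes xy: "biorthogonal x y"
  shows "hereditarily_complete x \<longleftrightarrow>
    (\<forall>\<tau> h. (\<forall>k\<in>\<tau>. ip h (x k) = 0) \<longrightarrow> (\<forall>k. k \<notin> \<tau> \<longrightarrow> ip h (y k) = 0) \<longrightarrow> h = 0)"
    (is "_ \<longleftrightarrow> ?mixed")
proof
  assume hc: "hereditarily_complete x"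
  \<comment> \<open>The definition only supplies some biorthogonal system; uniqueness identifies it
    with \<open>y\<close>.\<close>
  then have h_in: "h \<in> closed_span (x ` {k. ip h (y k) \<noteq> 0})" for h
    using biorthogonal_unique[OF _ xy]
    unfolding hereditarily_complete_def closed_span_scale_range by blast
  show ?mixed
  proof (intro allI impI)
    fix \<tau> h
    assume "\<forall>k\<in>\<tau>. ip h (x k) = 0" "\<forall>k. k \<notin> \<tau> \<longrightarrow> ip h (y k) = 0"
    then show "h = 0"
      using ip_eq_0_commute by (intro orthogonal_closed_span[OF _ h_in]) blast
  qed
next
  assume mixed: ?mixed
  have h_in: "h \<in> closed_span (x ` {k. k \<in> \<tau>})" if "\<And>k. k \<notin> \<tau> \<Longrightarrow> ip h (y k) = 0" for h \<tau>
  proof -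
    obtain p where p: "p \<in> closed_span (x ` \<tau>)"
      and orth: "\<And>s. s \<in> closed_span (x ` \<tau>) \<Longrightarrow> ip s (h - p) = 0"
      using orthogonal_projection_exists by blast
    have "ip (h - p) (x k) = 0" if "k \<in> \<tau>" for k
      using orth closed_span_base that ip_eq_0_commute by blast
    moreover have "ip (h - p) (y k) = 0" if "k \<notin> \<tau>" for k
    proof -
      have "ip p (y k) = 0"
        by (rule ip_closed_span_eq_0[OF _ p]) (use xy that in \<open>auto simp: biorthogonal_def\<close>)
      then show ?thesis using \<open>\<And>k. k \<notin> \<tau> \<Longrightarrow> ip h (y k) = 0\<close> that by (simp add: ip_diff_left)
    qed
    ultimately have "h - p = 0" using mixed by blast
    then show ?thesis using p by simp
  qed
  \<comment> \<open>For \<tau> = \<open>UNIV\<close> the condition on \<open>h\<close> is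
    vacuous.\<close>
  have "complete_system x"
    using h_in[of UNIV] by (auto simp: complete_system_def)
  moreover have "h \<in> closed_span (x ` {k. ip h (y k) \<noteq> 0})" for h
    using h_in[of "{k. ip h (y k) \<noteq> 0}" h] by simp
  ultimately show "hereditarily_complete x"
    using xy biorthogonal_imp_minimal
    unfolding hereditarily_complete_def closed_span_scale_range by blast
qed

lemma hereditarily_complete_mixed_system:
  assumes hc: "hereditarily_complete x" and xy: "biorthogonal x y"
  shows "hereditarily_complete (\<lambda>k. if k \<in> \<sigma> then x k else y k)"
proof -
  define X where "X = closed_span (x ` \<sigma>)"
  obtain P where P: "\<And>h. P h \<in> X" and PX: "\<And>h s. s \<in> X \<Longrightarrow> ip s (h - P h) = 0"
    using orthogonal_projection_exists[of "x ` \<sigma>"] unfolding X_def by metis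
  have PX': "ip (h - P h) s = 0" if "s \<in> X" for h s
    using PX that ip_eq_0_commute by blast
  have xX: "x k \<in> X" if "k \<in> \<sigma>" for k
    using that by (simp add: X_def closed_span_base)
  have Xy: "ip s (y k) = 0" if "s \<in> X" "k \<notin> \<sigma>" for s k
    by (rule ip_closed_span_eq_0[OF _ that(1)[unfolded X_def]])
      (use xy that in \<open>auto simp: biorthogonal_def\<close>)
  have yX: "ip (y k) s = 0" if "s \<in> X" "k \<notin> \<sigma>" for s k
    using Xy that ip_eq_0_commute by blast
  \<comment> \<open>The field axiom at 1 shows that conjugation fixes 1.\<close>
  have yx: "ip (y k) (x j) = (if k = j then 1 else 0)" for k j
    using xy ip_commute[of "y k" "x j"] mult_conjugate_eq_norm[of "1 :: 'k"]
    by (auto simp: biorthogonal_def)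
  define w where "w k = (if k \<in> \<sigma> then x k else y k)" for k
  define v where "v k = (if k \<in> \<sigma> then P (y k) else x k - P (x k))" for k
  have xP: "ip s (P h) = ip s h" if "s \<in> X" for s h
    using PX[OF that, of h] by (simp add: ip_diff_right)
  \<comment> \<open>Off \<sigma>, \<open>w k = y k\<close> is orthogonal to \<open>X\<close>, hence
    to all values of \<open>P\<close>; on \<sigma>, \<open>w k\<close> lies in \<open>X\<close>,
    where pairing with \<open>P g\<close> equals pairing with \<open>g\<close>.\<close>
  have "biorthogonal w v"
    unfolding biorthogonal_def
  proof (intro allI)
    fix k j
    show "ip (w k) (v j) = (if k = j then 1 else 0)"
      using xy xP[OF xX] PX[OF xX] yX[OF P] yx[of k j]
      by (auto simp: w_def v_def biorthogonal_def ip_diff_right)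
  qed
  moreover have "h = 0" if hw: "\<forall>k\<in>\<tau>. ip h (w k) = 0" and hv: "\<forall>k. k \<notin> \<tau> \<longrightarrow> ip h (v k) = 0"
    for \<tau> h
  proof -
    have mixed: "g = 0" if "\<And>k. k \<in> \<rho> \<Longrightarrow> ip g (x k) = 0" "\<And>k. k \<notin> \<rho> \<Longrightarrow> ip g (y k) = 0" for \<rho> g
      using hc that unfolding hereditarily_complete_iff_mixed_complete[OF xy] by blast
    have "P h = 0"
    \<comment> \<open>Off \<sigma>, \<open>y k\<close> is orthogonal to \<open>X\<close>. For
      \<open>k\<close> in \<sigma> but not in \<tau>, moving \<open>P\<close> across the inner
      product turns \<open>ip (P h) (y k)\<close> into \<open>ip h (v k)\<close>.\<close>
    proof (rule mixed[of "\<sigma> \<inter> \<tau>"])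
      show "ip (P h) (x k) = 0" if "k \<in> \<sigma> \<inter> \<tau>" for k
        using that bspec[OF hw, of k] PX'[OF xX, of k h] by (simp add: w_def ip_diff_left)
      show "ip (P h) (y k) = 0" if "k \<notin> \<sigma> \<inter> \<tau>" for k
      proof (cases "k \<in> \<sigma>")
        case True
        then have "ip h (P (y k)) = 0" using that hv[rule_format, of k] by (simp add: v_def)
        then show ?thesis
          using PX'[OF P, of h "y k"] xP[OF P, of h "y k"] by (simp add: ip_diff_left)
      qed (rule Xy[OF P])
    qed
    moreover have "h - P h = 0"
    \<comment> \<open>On \<sigma>, \<open>x k\<close> lies in \<open>X\<close>. For \<open>k\<close>
      in neither \<sigma> nor \<tau>, \<open>ip (h - P h) (x k)\<close> equals
      \<open>ip h (v k)\<close>, since \<open>h - P h\<close> is orthogonal to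
      \<open>P (x k)\<close> and \<open>P h\<close> to \<open>v k\<close>.\<close>
    proof (rule mixed[of "\<sigma> \<union> - \<tau>"])
      show "ip (h - P h) (x k) = 0" if "k \<in> \<sigma> \<union> - \<tau>" for k
      proof (cases "k \<in> \<sigma>")
        case False
        then have "ip h (x k - P (x k)) = 0" using that hv[rule_format, of k] by (simp add: v_def)
        then show ?thesis
          using PX[OF P, of h "x k"] PX'[OF P, of h "x k"]
          by (simp add: ip_diff_left ip_diff_right)
      qed (rule PX'[OF xX])
      show "ip (h - P h) (y k) = 0" if "k \<notin> \<sigma> \<union> - \<tau>" for k
        using that bspec[OF hw, of k] Xy[OF P, of k h] by (simp add: w_def ip_diff_left)
    qed
    ultimately show ?thesis by simp
  qed
  ultimately have "hereditarily_complete w"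
    using hereditarily_complete_iff_mixed_complete by blast
  then show ?thesis by (simp add: w_def[abs_def])
qed

end

theorem theorem18:
  fixes scale :: "'k::rc_field \<Rightarrow> 'h::banach \<Rightarrow> 'h"
    and ip :: "'h \<Rightarrow> 'h \<Rightarrow> 'k"
    and x xs :: "nat \<Rightarrow> 'h"
    and \<sigma> :: "nat set"
  assumes "hilbert_space scale ip"
    and "separable_space (euclidean :: 'h topology)"
    and "hilbert_space.hereditarily_complete scale ip x"
    and "hilbert_space.biorthogonal ip x xs"
  shows "hilbert_space.hereditarily_complete scale ip (\<lambda>k. if k \<in> \<sigma> then x k else xs k)"
  using hilbert_space.hereditarily_complete_mixed_system[OF assms(1,3,4)] .

end
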